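(* Let $T$ be a parsing of $n_o\ge 2$ options, and suppose that all options have equal value, i.e. $v_i=v>0$ for all $i\in\{1,\dots,n_o\}$. Then the tree dynamics $\dot{\mathbf z}=f_z(\mathbf z,\mathbf v)$ defined by $T$ are equivariant under permutations of $\mathbf z$ corresponding to isomorphisms of $T$; that is, $$f_z(\gamma\mathbf z,\mathbf v)=\gamma f_z(\mathbf z,\mathbf v)\quad\text{for all }\gamma\in\Gamma_T.$$
   Context: Seeley et al. dynamics: for $\mathbf m=(m_1,m_2)$, $\mathbf v=(v_1,v_2)$ with $v_1,v_2>0$, and a constant $\sigma>0$, $\dot{\mathbf m}=f(\mathbf m,\mathbf v)$ is $\dot m_i=v_i m_U-m_i\left(\frac1{v_i}-v_i m_U+\sigma(1-m_i-m_U)\right)$, $i=1,2$, with $m_U=1-m_1-m_2$. A parsing of $n_o$ options is a proper rooted binary tree $T$ (each internal node $i$ has a left child $\mathrm{lc}(i)$ and a right child $\mathrm{rc}(i)$) whose leaves represent the options; $o(i)$ is the option of leaf $i$, $n_i$ is the number of internal nodes, and the root is node $0$. Given option values $v_1,\dots,v_{n_o}>0$, each node $i$ has value $u_i=v_{o(i)}$ if $i$ is a leaf and $u_i=(u_{\mathrm{lc}(i)}+u_{\mathrm{rc}(i)})/2$ if $i$ is internal. Each internal node $i$ has value vector $\mathbf v_i=(u_{\mathrm{lc}(i)},u_{\mathrm{rc}(i)})$ and state $\mathbf m_i=(m_{i1},m_{i2})$ evolving by $\dot{\mathbf m}_i=f(\mathbf m_i,\mathbf v_i)$; $\mathbf v\in\mathbb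 R^{2n_i}$ stacks the $\mathbf v_i$ in depth-first order. Node states: $z_0=1$, $z_{\mathrm{lc}(i)}=z_i m_{i1}$, $z_{\mathrm{rc}(i)}=z_i m_{i2}$ for internal $i$; $\mathbf z_i=(z_{\mathrm{lc}(i)},z_{\mathrm{rc}(i)})=z_i\mathbf m_i$, and $\mathbf z\in\mathbb R^{2n_i}$ stacks the $\mathbf z_i$ over internal nodes in depth-first order. The vector field $f_z$ is defined where $z_i\neq0$ for all internal nodes $i$ by $\dot{\mathbf z}_i=\dot z_i\mathbf m_i+z_i f(\mathbf m_i,\mathbf v_i)$ with $\mathbf m_i=\mathbf z_i/z_i$, $\dot z_0=0$. An isomorphism of $T$ is a bijection $\varphi$ of the node set of $T$ to itself that fixes the root and satisfies: $(u,w)$ is an edge iff $(\varphi(u),\varphi(w))$ is an edge. These form the group $\Gamma_T$. It acts on $\mathbb R^{2n_i}$ by permuting coordinates: the coordinates are indexed by the non-root nodes of $T$ (the two coordinates of block $i$ correspond to $\mathrm{lc}(i)$ and $\mathrm{rc}(i)$), and the coordinate of $\gamma\mathbf z$ at node $\gamma(j)$ equals the coordinate of $\mathbf z$ at node $j$. *)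

theory Defs
  imports "HOL-Analysis.Product_Vector" "HOL-Combinatorics.Permutations" "Jordan_Normal_Form.Matrix"
begin

definition f :: "real \<Rightarrow> real \<times> real \<Rightarrow> real \<times> real \<Rightarrow> real \<times> real" where
  "f \<sigma> m v =
     (let mU = 1 - fst m - snd m;
          g = (\<lambda>mi vi. vi * mU - mi * (1 / vi - vi * mU + \<sigma> * (1 - mi - mU)))
      in (g (fst m) (fst v), g (snd m) (snd v)))"

text \<open>A leaf carries the number of the option it represents.\<close>

datatype parsing = Leaf nat | Node parsing parsing

fun options :: "parsing \<Rightarrow> nat list" where
  "options (Leaf k) = [k]"
| "options (Node l r) = options l @ options r"

definition parsing_of :: "nat \<Rightarrow> parsing \<Rightarrow> bool" where
  "parsing_of no T \<longleftrightarrow> distinct (options T) \<and> set (options T) = {1..no}"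

text \<open>
  A node is the path leading to it from the root, with the last step at the head of the list.
  So the root (node 0) is the empty list and the children of a node arise by prepending a side.
\<close>

datatype side = Lft | Rgt

type_synonym node = "side list"

abbreviation (input) root_node :: node where "root_node \<equiv> []"
abbreviation (input) lc :: "node \<Rightarrow> node" where "lc i \<equiv> Lft # i"
abbreviation (input) rc :: "node \<Rightarrow> node" where "rc i \<equiv> Rgt # i"

text \<open>In the next two functions, \<open>p\<close> is the node of the ambient tree at which the subtree sits;
  both lists are in depth-first (pre-)order.\<close>

fun nodes_from :: "node \<Rightarrow> parsing \<Rightarrow> node list" where
  "nodes_from p (Leaf k) = [p]"
| "nodes_from p (Node l r) = p # nodes_from (lc p) l @ nodes_from (rc p) r"

fun internals_from :: "node \<Rightarrow> parsing \<Rightarrow> node list" where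
  "internals_from p (Leaf k) = []"
| "internals_from p (Node l r) = p # internals_from (lc p) l @ internals_from (rc p) r"

definition nodes :: "parsing \<Rightarrow> node set" where
  "nodes T = set (nodes_from root_node T)"

definition internals :: "parsing \<Rightarrow> node list" where
  "internals T = internals_from root_node T"

definition n_i :: "parsing \<Rightarrow> nat" where
  "n_i T = length (internals T)"

definition edges :: "parsing \<Rightarrow> (node \<times> node) set" where
  "edges T = (\<Union>i\<in>set (internals T). {(i, lc i), (i, rc i)})"

text \<open>
  Vectors in \<open>\<real>\<^sup>2\<^sup>n\<close> with \<open>n = n_i T\<close>: coordinate number \<open>k\<close> belongs to the non-root node
  \<open>coord_nodes T ! k\<close>.
\<close>

definition coord_nodes :: "parsing \<Rightarrow> node list" where
  "coord_nodes T = concat (map (\<lambda>i. [lc i, rc i]) (internals T))"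

definition stack :: "parsing \<Rightarrow> (node \<Rightarrow> real) \<Rightarrow> real vec" where
  "stack T g = vec (2 * n_i T) (\<lambda>k. g (coord_nodes T ! k))"

definition coord :: "parsing \<Rightarrow> real vec \<Rightarrow> node \<Rightarrow> real" where
  "coord T x j = x $ (THE k. k < 2 * n_i T \<and> coord_nodes T ! k = j)"

definition block :: "parsing \<Rightarrow> real vec \<Rightarrow> node \<Rightarrow> real \<times> real" where
  "block T x i = (coord T x (lc i), coord T x (rc i))"

text \<open>Only the values of \<open>subtree T i\<close> for \<open>i \<in> nodes T\<close> are meaningful.\<close>

fun subtree :: "parsing \<Rightarrow> node \<Rightarrow> parsing" where
  "subtree T [] = T"
| "subtree T (s # i) =
     (case subtree T i of
        Leaf k \<Rightarrow> Leaf k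
      | Node l r \<Rightarrow> (case s of Lft \<Rightarrow> l | Rgt \<Rightarrow> r))"

fun mean_value :: "(nat \<Rightarrow> real) \<Rightarrow> parsing \<Rightarrow> real" where
  "mean_value w (Leaf k) = w k"
| "mean_value w (Node l r) = (mean_value w l + mean_value w r) / 2"

definition node_value :: "parsing \<Rightarrow> (nat \<Rightarrow> real) \<Rightarrow> node \<Rightarrow> real" where
  "node_value T w i = mean_value w (subtree T i)"

definition value_vec :: "parsing \<Rightarrow> (nat \<Rightarrow> real) \<Rightarrow> real vec" where
  "value_vec T w = stack T (node_value T w)"

definition node_state :: "parsing \<Rightarrow> real vec \<Rightarrow> node \<Rightarrow> real" where
  "node_state T z i = (if i = root_node then 1 else coord T z i)"

definition node_m :: "parsing \<Rightarrow> real vec \<Rightarrow> node \<Rightarrow> real \<times> real" where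
  "node_m T z i = block T z i /\<^sub>R node_state T z i"

text \<open>
  The rate of change of a non-root node's state is a component of the block of its parent \<open>i\<close>,
  so the derivative of the node state in the equation for block \<open>i\<close> comes from the recursion
  along the path, starting from 0 at the root.
\<close>

fun node_rate :: "real \<Rightarrow> parsing \<Rightarrow> real vec \<Rightarrow> real vec \<Rightarrow> node \<Rightarrow> real" where
  "node_rate \<sigma> T z v [] = 0"
| "node_rate \<sigma> T z v (s # i) =
     (case s of Lft \<Rightarrow> fst | Rgt \<Rightarrow> snd)
       (node_rate \<sigma> T z v i *\<^sub>R node_m T z i
        + node_state T z i *\<^sub>R f \<sigma> (node_m T z i) (block T v i))"

definition fz_domain :: "parsing \<Rightarrow> real vec set" where
  "fz_domain T =
     {z \<in> carrier_vec (2 * n_i T). \<forall>i\<in>set (internals T). node_state T z i \<noteq> 0}"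

definition fz :: "real \<Rightarrow> parsing \<Rightarrow> real vec \<Rightarrow> real vec \<Rightarrow> real vec" where
  "fz \<sigma> T z v = stack T (node_rate \<sigma> T z v)"

text \<open>Bijections of the node set, extended by the identity to all paths.\<close>

definition tree_isos :: "parsing \<Rightarrow> (node \<Rightarrow> node) set" where
  "tree_isos T =
     {\<phi>. \<phi> permutes nodes T \<and> \<phi> root_node = root_node \<and>
         (\<forall>u\<in>nodes T. \<forall>w\<in>nodes T. (u, w) \<in> edges T \<longleftrightarrow> (\<phi> u, \<phi> w) \<in> edges T)}"

text \<open>The coordinate of \<open>act T \<gamma> x\<close> at node \<open>\<gamma> j\<close> is the coordinate of \<open>x\<close> at node \<open>j\<close>.\<close>

definition act :: "parsing \<Rightarrow> (node \<Rightarrow> node) \<Rightarrow> real vec \<Rightarrow> real vec" where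
  "act T \<gamma> x = stack T (\<lambda>j. coord T x (inv_into (nodes T) \<gamma> j))"

end

theory Submission imports Defs begin

text \<open>
  Every node value is a mean of option values, hence equal to the common value \<open>v\<close>.
  With the value vector \<open>(v, v)\<close>, each component of \<open>f\<close> is one and the same function of the
  corresponding component of \<open>\<^bold>m\<close> and of the sum of both components (\<open>side_proj_f_equal_values\<close>).
  An isomorphism \<open>\<gamma>\<close> sends the two children of an internal node \<open>i\<close> to the two children of the
  internal node \<open>\<gamma> i\<close>, possibly interchanged, so it preserves that sum and matches the
  components. Node states, and by recursion along the path from the root also their rates of
  change, are therefore carried along by \<open>\<gamma>\<close> (\<open>node_rate_act\<close>); this is the equivariance, read
  off coordinate by coordinate.
\<close>

section \<open>Nodes and coordinates\<close>

lemma set_nodes_from: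
  "set (nodes_from p T) = insert p (\<Union>i\<in>set (internals_from p T). {lc i, rc i})"
  by (induction p T rule: nodes_from.induct) auto

lemma internals_from_suffix: "i \<in> set (internals_from p T) \<Longrightarrow> \<exists>q. i = q @ p"
proof (induction p T rule: internals_from.induct)
  case (2 p l r)
  show ?case
  proof (cases "i = p")
    case False
    then consider "\<exists>q. i = q @ lc p" | "\<exists>q. i = q @ rc p"
      using 2 by auto
    then show ?thesis
      by (metis append.assoc append_Cons append_Nil)
  qed simp
qed simp

lemma distinct_internals_from: "distinct (internals_from p T)"
proof (induction p T rule: internals_from.induct)
  case (2 p l r)
  have root: "p \<notin> set (internals_from (s # p) T')" for s T'
    using internals_from_suffix[of p "s # p" T'] by auto
  have "set (internals_from (lc p) l) \<inter> set (internals_from (rc p) r) = {}"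
  proof (rule ccontr)
    assume "\<not> ?thesis"
    then obtain i where "i \<in> set (internals_from (lc p) l)" "i \<in> set (internals_from (rc p) r)"
      by blast
    then obtain q q' where "q @ lc p = q' @ rc p"
      using internals_from_suffix by metis
    then show False
      by (simp add: append_eq_append_conv2)
  qed
  with 2 root show ?case by simp
qed simp

lemma set_coord_nodes: "set (coord_nodes T) = (\<Union>i\<in>set (internals T). {lc i, rc i})"
  by (simp add: coord_nodes_def insert_commute)

lemma Cons_in_coord_nodes_iff: "s # i \<in> set (coord_nodes T) \<longleftrightarrow> i \<in> set (internals T)"
  by (cases s) (auto simp: set_coord_nodes)

lemma nodes_eq_insert_coord_nodes: "nodes T = insert root_node (set (coord_nodes T))"
  by (simp add: nodes_def internals_def set_nodes_from set_coord_nodes)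

lemma coord_nodes_iff: "j \<in> set (coord_nodes T) \<longleftrightarrow> j \<in> nodes T \<and> j \<noteq> root_node"
  by (auto simp: nodes_eq_insert_coord_nodes set_coord_nodes)

lemma Cons_in_nodes_iff: "s # i \<in> nodes T \<longleftrightarrow> i \<in> set (internals T)"
  by (simp add: nodes_eq_insert_coord_nodes Cons_in_coord_nodes_iff)

lemma internals_subset_nodes: "set (internals T) \<subseteq> nodes T"
proof -
  have "set (internals_from p T) \<subseteq> set (nodes_from p T)" for p
    by (induction p T rule: nodes_from.induct) auto
  then show ?thesis by (simp add: internals_def nodes_def)
qed

lemma edges_iff: "(i, j) \<in> edges T \<longleftrightarrow> i \<in> set (internals T) \<and> (\<exists>s. j = s # i)"
proof -
  have "(\<exists>s. P s) \<longleftrightarrow> P Lft \<or> P Rgt" for P :: "side \<Rightarrow> bool"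
    by (metis side.exhaust)
  then show ?thesis by (auto simp: edges_def)
qed

lemma distinct_coord_nodes: "distinct (coord_nodes T)"
proof -
  have "distinct (concat (map (\<lambda>i. [lc i, rc i]) xs))" if "distinct xs" for xs :: "node list"
    using that by (induction xs) auto
  then show ?thesis
    by (simp add: coord_nodes_def internals_def distinct_internals_from)
qed

lemma length_coord_nodes: "length (coord_nodes T) = 2 * n_i T"
proof -
  have "length (concat (map (\<lambda>i. [lc i, rc i]) xs)) = 2 * length xs" for xs :: "node list"
    by (induction xs) auto
  then show ?thesis by (simp add: coord_nodes_def n_i_def)
qed

lemma coord_stack:
  assumes "j \<in> set (coord_nodes T)"
  shows "coord T (stack T g) j = g j"
proof -
  obtain k where k: "k < 2 * n_i T" "coord_nodes T ! k = j"
    using assms by (metis in_set_conv_nth length_coord_nodes)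
  then have "(THE k. k < 2 * n_i T \<and> coord_nodes T ! k = j) = k"
    using distinct_coord_nodes[of T] by (auto simp: distinct_conv_nth length_coord_nodes)
  with k show ?thesis by (simp add: coord_def stack_def)
qed

lemma stack_cong:
  assumes "\<And>j. j \<in> set (coord_nodes T) \<Longrightarrow> g j = h j"
  shows "stack T g = stack T h"
  unfolding stack_def by (rule eq_vecI) (auto simp: assms length_coord_nodes)

section \<open>Equal option values\<close>

lemma options_subtree: "set (options (subtree T i)) \<subseteq> set (options T)"
  by (induction i) (auto split: parsing.splits side.splits)

lemma mean_value_const:
  "(\<And>k. k \<in> set (options T) \<Longrightarrow> w k = v) \<Longrightarrow> mean_value w T = v"
  by (induction T) auto

lemma block_value_vec_const:
  assumes "\<And>k. k \<in> set (options T) \<Longrightarrow> w k = v" and "i \<in> set (internals T)"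
  shows "block T (value_vec T w) i = (v, v)"
proof -
  have "node_value T w j = v" for j
    unfolding node_value_def using assms(1) options_subtree by (intro mean_value_const) blast
  then show ?thesis
    using assms(2) by (simp add: block_def value_vec_def coord_stack Cons_in_coord_nodes_iff)
qed

text \<open>The component of a pair of child quantities that belongs to the child on the given side.\<close>

abbreviation side_proj :: "side \<Rightarrow> real \<times> real \<Rightarrow> real" where
  "side_proj s \<equiv> (case s of Lft \<Rightarrow> fst | Rgt \<Rightarrow> snd)"

lemma side_proj_block: "side_proj s (block T x i) = coord T x (s # i)"
  by (simp add: block_def split: side.split)

lemma side_proj_add: "side_proj s (x + y) = side_proj s x + side_proj s y"
  by (simp split: side.split)

lemma side_proj_scaleR: "side_proj s (c *\<^sub>R x) = c * side_proj s x"
  by (simp split: side.split)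

text \<open>
  The commitment rate of an option of value \<open>v\<close>, as a function of the fraction \<open>x\<close> committed to
  it and of the total committed fraction \<open>t\<close>. This is the right-hand side common to both
  components of \<open>f\<close> when the two values are equal.
\<close>

definition commit_rate :: "real \<Rightarrow> real \<Rightarrow> real \<Rightarrow> real \<Rightarrow> real" where
  "commit_rate \<sigma> v t x =
     v * (1 - t) - x * (1 / v - v * (1 - t) + \<sigma> * (1 - x - (1 - t)))"

lemma side_proj_f_equal_values:
  "side_proj s (f \<sigma> m (v, v)) = commit_rate \<sigma> v (fst m + snd m) (side_proj s m)"
  by (simp add: f_def commit_rate_def Let_def diff_diff_eq split: side.split)

section \<open>Isomorphisms and the permutation action\<close>

context
  fixes T :: parsing and \<gamma> :: "node \<Rightarrow> node"
  assumes iso: "\<gamma> \<in> tree_isos T"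
begin

lemma iso_bij: "bij_betw \<gamma> (nodes T) (nodes T)"
  using iso by (simp add: tree_isos_def permutes_imp_bij)

lemma iso_inj: "inj_on \<gamma> (nodes T)"
  using iso_bij by (simp add: bij_betw_def)

lemma iso_nodes: "j \<in> nodes T \<Longrightarrow> \<gamma> j \<in> nodes T"
  using iso_bij by (auto simp: bij_betw_def)

lemma iso_nodes_surj:
  assumes "j \<in> nodes T"
  obtains k where "k \<in> nodes T" "\<gamma> k = j"
  using assms bij_betw_imp_surj_on[OF iso_bij] by (metis imageE)

lemma iso_root: "\<gamma> root_node = root_node"
  using iso by (simp add: tree_isos_def)

lemma iso_eq_root_iff: "j \<in> nodes T \<Longrightarrow> \<gamma> j = root_node \<longleftrightarrow> j = root_node"
  using iso_inj iso_root by (metis inj_onD insertI1 nodes_eq_insert_coord_nodes)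

lemma iso_edges_iff:
  "u \<in> nodes T \<Longrightarrow> w \<in> nodes T \<Longrightarrow> (\<gamma> u, \<gamma> w) \<in> edges T \<longleftrightarrow> (u, w) \<in> edges T"
  using iso by (simp add: tree_isos_def)

lemma iso_coord_nodes: "j \<in> set (coord_nodes T) \<Longrightarrow> \<gamma> j \<in> set (coord_nodes T)"
  by (simp add: coord_nodes_iff iso_nodes iso_eq_root_iff)

lemma iso_coord_nodes_surj:
  assumes "j \<in> set (coord_nodes T)"
  obtains k where "k \<in> set (coord_nodes T)" "\<gamma> k = j"
proof -
  obtain k where "k \<in> nodes T" "\<gamma> k = j"
    using assms iso_nodes_surj by (auto simp: coord_nodes_iff)
  with assms that show ?thesis by (metis coord_nodes_iff iso_root)
qed

lemma iso_child:
  assumes "i \<in> set (internals T)"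
  obtains s' where "\<gamma> (s # i) = s' # \<gamma> i"
proof -
  have "(\<gamma> i, \<gamma> (s # i)) \<in> edges T"
    using assms internals_subset_nodes
    by (subst iso_edges_iff) (auto simp: Cons_in_nodes_iff edges_iff)
  with that show ?thesis by (auto simp: edges_iff)
qed

lemma iso_internals: "i \<in> set (internals T) \<Longrightarrow> \<gamma> i \<in> set (internals T)"
  by (metis Cons_in_nodes_iff iso_child iso_nodes)

lemma iso_internals_surj:
  assumes "j \<in> set (internals T)"
  obtains i where "i \<in> set (internals T)" "\<gamma> i = j"
proof -
  obtain i where i: "i \<in> nodes T" "\<gamma> i = j"
    using assms internals_subset_nodes iso_nodes_surj by (metis subsetD)
  obtain k where k: "k \<in> nodes T" "\<gamma> k = lc j"
    using assms iso_coord_nodes_surj by (metis Cons_in_coord_nodes_iff coord_nodes_iff)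
  \<comment> \<open>The edge from \<open>j\<close> to its left child pulls back to an edge starting at \<open>i\<close>.\<close>
  have "(\<gamma> i, \<gamma> k) \<in> edges T"
    using assms i k by (simp add: edges_iff)
  then have "i \<in> set (internals T)"
    using iso_edges_iff[OF i(1) k(1)] by (simp add: edges_iff)
  with i that show ?thesis by blast
qed

lemma coord_act:
  assumes "j \<in> set (coord_nodes T)"
  shows "coord T (act T \<gamma> x) (\<gamma> j) = coord T x j"
  using assms iso_inj
  by (simp add: act_def coord_stack iso_coord_nodes inv_into_f_f coord_nodes_iff[of j])

lemma coord_sum_children_act:
  assumes i: "i \<in> set (internals T)"
  shows "coord T (act T \<gamma> x) (lc (\<gamma> i)) + coord T (act T \<gamma> x) (rc (\<gamma> i))
         = coord T x (lc i) + coord T x (rc i)"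
proof -
  obtain s where s: "\<gamma> (lc i) = s # \<gamma> i" using i by (rule iso_child)
  obtain s' where s': "\<gamma> (rc i) = s' # \<gamma> i" using i by (rule iso_child)
  have "\<gamma> (lc i) \<noteq> \<gamma> (rc i)"
    using i iso_inj by (auto simp: Cons_in_nodes_iff dest: inj_onD)
  then have "s \<noteq> s'" using s s' by auto
  moreover have "coord T (act T \<gamma> x) (s # \<gamma> i) = coord T x (lc i)"
    using i s coord_act[of "lc i"] by (simp add: Cons_in_coord_nodes_iff)
  moreover have "coord T (act T \<gamma> x) (s' # \<gamma> i) = coord T x (rc i)"
    using i s' coord_act[of "rc i"] by (simp add: Cons_in_coord_nodes_iff)
  ultimately show ?thesis by (cases s; cases s') auto
qed

lemma node_state_act:
  assumes "j \<in> nodes T"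
  shows "node_state T (act T \<gamma> z) (\<gamma> j) = node_state T z j"
  using assms by (simp add: node_state_def iso_eq_root_iff coord_act coord_nodes_iff)

lemma act_fz_domain:
  assumes "z \<in> fz_domain T"
  shows "act T \<gamma> z \<in> fz_domain T"
proof -
  have "node_state T (act T \<gamma> z) i \<noteq> 0" if i: "i \<in> set (internals T)" for i
  proof -
    obtain k where k: "k \<in> set (internals T)" "\<gamma> k = i"
      using i by (rule iso_internals_surj)
    then have "node_state T (act T \<gamma> z) i = node_state T z k"
      using internals_subset_nodes node_state_act by blast
    with k assms show ?thesis by (simp add: fz_domain_def)
  qed
  then show ?thesis by (simp add: fz_domain_def act_def stack_def)
qed

text \<open>
  The induction runs along the path to \<open>j\<close>: the rate at a child involves the rate at its parent.
\<close>

lemma node_rate_act: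
  assumes equal_values: "\<And>i. i \<in> set (internals T) \<Longrightarrow> block T x i = (v, v)"
    and "j \<in> nodes T"
  shows "node_rate \<sigma> T (act T \<gamma> z) x (\<gamma> j) = node_rate \<sigma> T z x j"
  using assms(2)
proof (induction j)
  case Nil
  show ?case by (simp add: iso_root)
next
  case (Cons s i)
  let ?z' = "act T \<gamma> z"
  have i: "i \<in> set (internals T)" using Cons.prems by (simp add: Cons_in_nodes_iff)
  then have i_node: "i \<in> nodes T" using internals_subset_nodes by blast
  obtain s' where s': "\<gamma> (s # i) = s' # \<gamma> i" using i by (rule iso_child)
  note state = node_state_act[OF i_node, of z]
  have proj: "side_proj s' (node_m T ?z' (\<gamma> i)) = side_proj s (node_m T z i)"
    using coord_act[of "s # i" z] i s'
    by (simp add: node_m_def side_proj_scaleR side_proj_block state Cons_in_coord_nodes_iff)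
  have total: "fst (node_m T ?z' (\<gamma> i)) + snd (node_m T ?z' (\<gamma> i))
      = fst (node_m T z i) + snd (node_m T z i)"
    using coord_sum_children_act[OF i, of z]
    by (simp add: node_m_def block_def state flip: distrib_left)
  show ?case
    using Cons.IH[OF i_node]
    by (simp add: s' side_proj_add side_proj_scaleR equal_values i iso_internals
        side_proj_f_equal_values proj total state)
qed

lemma fz_act:
  assumes "\<And>i. i \<in> set (internals T) \<Longrightarrow> block T x i = (v, v)"
  shows "fz \<sigma> T (act T \<gamma> z) x = act T \<gamma> (fz \<sigma> T z x)"
  unfolding fz_def act_def[of T \<gamma> "stack T _"]
proof (rule stack_cong)
  fix j assume "j \<in> set (coord_nodes T)"
  then obtain k where k: "k \<in> set (coord_nodes T)" "\<gamma> k = j"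
    by (rule iso_coord_nodes_surj)
  then have "k \<in> nodes T" by (simp add: coord_nodes_iff)
  moreover from this have "inv_into (nodes T) \<gamma> j = k"
    using k(2) iso_inj by (metis inv_into_f_f)
  ultimately show "node_rate \<sigma> T (act T \<gamma> z) x j
      = coord T (stack T (node_rate \<sigma> T z x)) (inv_into (nodes T) \<gamma> j)"
    using node_rate_act[OF assms, where j = k] k by (simp add: coord_stack)
qed

end

section \<open>Equivariance of the tree dynamics\<close>

theorem theorem4p5:
  fixes n_o :: nat and T :: parsing and w :: "nat \<Rightarrow> real" and v \<sigma> :: real
  assumes "n_o \<ge> 2"
    and "parsing_of n_o T"
    and "\<sigma> > 0"
    and "v > 0"
    and "\<forall>i\<in>{1..n_o}. w i = v"
  shows "\<forall>\<gamma>\<in>tree_isos T. \<forall>z\<in>fz_domain T.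
           act T \<gamma> z \<in> fz_domain T \<and>
           fz \<sigma> T (act T \<gamma> z) (value_vec T w) = act T \<gamma> (fz \<sigma> T z (value_vec T w))"
proof -
  have "w k = v" if "k \<in> set (options T)" for k
    using that assms by (simp add: parsing_of_def)
  then have "block T (value_vec T w) i = (v, v)" if "i \<in> set (internals T)" for i
    using that by (rule block_value_vec_const)
  then show ?thesis
    by (intro ballI conjI act_fz_domain fz_act)
qed

end
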